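(* Let $\mathcal{P}_\times$ be the $\mathrm{Top}$-enriched category with one object $*$, endomorphism space $\mathcal{P}_\times( *,* )=[0,1]$, identity $1$, and composition given by ordinary multiplication $t\circ s=ts$. There is a strict symmetric monoidal structure and a cut structure on $\mathcal{P}_\times$ for which $\mathcal{P}_\times$ is a symmetric reparametrization category with cuts. Moreover, $\mathcal{P}_\times$ is not equivalent to the final category $\mathbf{1}$.
   Context: $\mathrm{Top}$ denotes either the category of $\Delta$-generated spaces (spaces whose topology is final with respect to all continuous maps from standard topological simplices) or its full subcategory of $\Delta$-Hausdorff ones (those for which the image of every continuous map $[0,1]\to X$ is closed). In either case $\mathrm{Top}$ is complete, cocomplete and cartesian closed. $\mathbf{1}$ is the category with one object and one morphism. "Not equivalent" means that the underlying ordinary categories are not equivalent (so that a fortiori no enriched or symmetric semimonoidal equivalence exists). A reparametrization category $(\mathcal{P},\otimes)$ is a small $\mathrm{Top}$-enriched semimonoidal category (an enriched bifunctor $\otimes$, associative, with no unit required) such that: (1) the semimonoidal structure is strict (so $\otimes$ makes $\mathrm{Obj}(\mathcal{P})$ a semigroup); (2) every hom-space $\mathcal{P}(\ell,\ell')$ is contractible; (3) if $\phi:\ell\to\ell'$ and $\ell'=\ell'_1\otimes\ell'_2$, there are objects $\ell_1,\ell_2$ and maps $\phi_i:\ell_i\to\ell'_i$ with $\ell=\ell_1\otimes\ell_2$ and $\phi=\phi_1\otimes\phi_2$. It is symmetric if it is equipped with enriched natural isomorphisms $\gamma_{X,Y}:X\otimes Y\to Y\otimes X$ satisfying the two hexagon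 identities and $\gamma_{Y,X}\gamma_{X,Y}=\mathrm{id}$. A strict symmetric monoidal structure is a strictly associative enriched tensor product with a strict unit object (identity unitors) together with such a symmetry. A cut structure on $\mathcal{P}$ consists of: for every object $L$ a map $\delta_L:L\to L\otimes L$ (not required to be natural); for all objects $L,a,b$ continuous maps $c_1^{a,b}:\mathcal{P}(L,a\otimes b)\to\mathcal{P}(L,a)$ and $c_2^{a,b}:\mathcal{P}(L,a\otimes b)\to\mathcal{P}(L,b)$ such that for all $\alpha:a\to a'$, $\beta:b\to b'$, $\psi:L\to a\otimes b$ one has $c_1^{a',b'}((\alpha\otimes\beta)\psi)=\alpha c_1^{a,b}(\psi)$ and $c_2^{a',b'}((\alpha\otimes\beta)\psi)=\beta c_2^{a,b}(\psi)$; and, putting $N_L^{a,b}(\psi)=(c_1^{a,b}(\psi)\otimes c_2^{a,b}(\psi))\delta_L$, continuous maps $\Theta_L^{a,b}:[0,1]\times\mathcal{P}(L,a\otimes b)\to\mathcal{P}(L,a\otimes b)$ with $\Theta_L^{a,b}(0,\psi)=\psi$, $\Theta_L^{a,b}(1,\psi)=N_L^{a,b}(\psi)$ and $\Theta_L^{a',b'}(u,(\alpha\otimes\beta)\psi)=(\alpha\otimes\beta)\Theta_L^{a,b}(u,\psi)$. A reparametrization category with cuts is a reparametrization category that admits a cut structure. *)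

theory Defs
  imports "HOL-Homology.Simplices"
begin

section \<open>The category Top\<close>

abbreviation simplex_space :: "nat \<Rightarrow> (nat \<Rightarrow> real) topology" where
  "simplex_space p \<equiv> subtopology (powertop_real UNIV) (standard_simplex p)"

text \<open>The final topology with respect to all continuous maps from standard simplices to \<open>X\<close>.\<close>

definition delta_kelleyfication :: "'a topology \<Rightarrow> 'a topology" where
  "delta_kelleyfication X = topology (\<lambda>U. U \<subseteq> topspace X \<and>
     (\<forall>p f. continuous_map (simplex_space p) X f \<longrightarrow>
        openin (simplex_space p) {x \<in> topspace (simplex_space p). f x \<in> U}))"

lemma openin_delta_kelleyfication:
  "openin (delta_kelleyfication X) U \<longleftrightarrow> U \<subseteq> topspace X \<and>
     (\<forall>p f. continuous_map (simplex_space p) X f \<longrightarrow>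
        openin (simplex_space p) {x \<in> topspace (simplex_space p). f x \<in> U})"
proof -
  let ?P = "\<lambda>U. U \<subseteq> topspace X \<and>
     (\<forall>p f. continuous_map (simplex_space p) X f \<longrightarrow>
        openin (simplex_space p) {x \<in> topspace (simplex_space p). f x \<in> U})"
  have "istopology ?P"
    unfolding istopology_def
  proof (intro conjI allI impI)
    fix S T p and f :: "(nat \<Rightarrow> real) \<Rightarrow> 'a"
    assume S: "?P S" and T: "?P T" and f: "continuous_map (simplex_space p) X f"
    have "{x \<in> topspace (simplex_space p). f x \<in> S \<inter> T} =
        {x \<in> topspace (simplex_space p). f x \<in> S} \<inter> {x \<in> topspace (simplex_space p). f x \<in> T}"
      by blast
    then show "openin (simplex_space p) {x \<in> topspace (simplex_space p). f x \<in> S \<inter> T}"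
      using S T f by (metis (no_types, lifting) openin_Int)
  next
    fix K p and f :: "(nat \<Rightarrow> real) \<Rightarrow> 'a"
    assume K: "\<forall>S\<in>K. ?P S" and f: "continuous_map (simplex_space p) X f"
    have "{x \<in> topspace (simplex_space p). f x \<in> \<Union>K} =
        \<Union>((\<lambda>S. {x \<in> topspace (simplex_space p). f x \<in> S}) ` K)"
      by blast
    moreover have "openin (simplex_space p) \<dots>"
      using K f by (intro openin_Union) blast
    ultimately show "openin (simplex_space p) {x \<in> topspace (simplex_space p). f x \<in> \<Union>K}"
      by simp
  qed blast+
  then show ?thesis
    by (simp add: delta_kelleyfication_def topology_inverse')
qed

definition delta_generated :: "'a topology \<Rightarrow> bool" where
  "delta_generated X \<longleftrightarrow> delta_kelleyfication X = X"

definition delta_Hausdorff :: "'a topology \<Rightarrow> bool" where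
  "delta_Hausdorff X \<longleftrightarrow>
     (\<forall>f. continuous_map (top_of_set {0..1::real}) X f \<longrightarrow> closedin X (f ` {0..1}))"

text \<open>The two possible meanings of Top.\<close>

datatype convenient_top = Delta_Generated | Delta_Generated_Hausdorff

fun Top_object :: "convenient_top \<Rightarrow> 'a topology \<Rightarrow> bool" where
  "Top_object Delta_Generated X \<longleftrightarrow> delta_generated X"
| "Top_object Delta_Generated_Hausdorff X \<longleftrightarrow> delta_generated X \<and> delta_Hausdorff X"

text \<open>
  The categorical product of Top. It is the \<open>\<Delta>\<close>-kelleyfication of the ordinary product, and is given
  by the same formula in both cases, because the \<open>\<Delta>\<close>-Hausdorff spaces are closed under this product.
\<close>

definition Top_prod :: "'a topology \<Rightarrow> 'b topology \<Rightarrow> ('a \<times> 'b) topology" where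
  "Top_prod X Y = delta_kelleyfication (prod_topology X Y)"


section \<open>Categories enriched over Top\<close>

text \<open>
  Hom-spaces for different pairs of objects are not required to be disjoint, so identities,
  composition and the tensor product of morphisms take the objects as arguments:
  \<open>Comp C x y z g f\<close> is the composite of \<open>f : x \<rightarrow> y\<close> and \<open>g : y \<rightarrow> z\<close>. Smallness is automatic,
  the objects being a set over a type.
\<close>

record ('o, 'm) top_cat =
  Obj :: "'o set"
  Hom :: "'o \<Rightarrow> 'o \<Rightarrow> 'm topology"
  Ident :: "'o \<Rightarrow> 'm"
  Comp :: "'o \<Rightarrow> 'o \<Rightarrow> 'o \<Rightarrow> 'm \<Rightarrow> 'm \<Rightarrow> 'm"

abbreviation mor :: "('o, 'm) top_cat \<Rightarrow> 'o \<Rightarrow> 'o \<Rightarrow> 'm set" where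
  "mor C x y \<equiv> topspace (Hom C x y)"

locale top_category =
  fixes T :: convenient_top and C :: "('o, 'm) top_cat"
  assumes hom_Top: "\<lbrakk>x \<in> Obj C; y \<in> Obj C\<rbrakk> \<Longrightarrow> Top_object T (Hom C x y)"
    and ident_mor: "x \<in> Obj C \<Longrightarrow> Ident C x \<in> mor C x x"
    and comp_continuous: "\<lbrakk>x \<in> Obj C; y \<in> Obj C; z \<in> Obj C\<rbrakk> \<Longrightarrow>
      continuous_map (Top_prod (Hom C y z) (Hom C x y)) (Hom C x z) (\<lambda>(g, f). Comp C x y z g f)"
    and comp_ident_right: "\<lbrakk>x \<in> Obj C; y \<in> Obj C; f \<in> mor C x y\<rbrakk> \<Longrightarrow>
      Comp C x x y f (Ident C x) = f"
    and comp_ident_left: "\<lbrakk>x \<in> Obj C; y \<in> Obj C; f \<in> mor C x y\<rbrakk> \<Longrightarrow>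
      Comp C x y y (Ident C y) f = f"
    and comp_assoc: "\<lbrakk>w \<in> Obj C; x \<in> Obj C; y \<in> Obj C; z \<in> Obj C;
        f \<in> mor C w x; g \<in> mor C x y; h \<in> mor C y z\<rbrakk> \<Longrightarrow>
      Comp C w x z (Comp C x y z h g) f = Comp C w y z h (Comp C w x y g f)"


section \<open>Strict semimonoidal and symmetric monoidal structures\<close>

text \<open>\<open>tmor M a a' b b' f g\<close> is the tensor product of \<open>f : a \<rightarrow> a'\<close> and \<open>g : b \<rightarrow> b'\<close>.\<close>

record ('o, 'm) tensor =
  tob :: "'o \<Rightarrow> 'o \<Rightarrow> 'o"
  tmor :: "'o \<Rightarrow> 'o \<Rightarrow> 'o \<Rightarrow> 'o \<Rightarrow> 'm \<Rightarrow> 'm \<Rightarrow> 'm"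

locale enriched_bifunctor = top_category T C
  for T :: convenient_top and C :: "('o, 'm) top_cat" +
  fixes M :: "('o, 'm) tensor"
  assumes tob_Obj: "\<lbrakk>a \<in> Obj C; b \<in> Obj C\<rbrakk> \<Longrightarrow> tob M a b \<in> Obj C"
    and tmor_continuous: "\<lbrakk>a \<in> Obj C; a' \<in> Obj C; b \<in> Obj C; b' \<in> Obj C\<rbrakk> \<Longrightarrow>
      continuous_map (Top_prod (Hom C a a') (Hom C b b')) (Hom C (tob M a b) (tob M a' b'))
        (\<lambda>(f, g). tmor M a a' b b' f g)"
    and tmor_ident: "\<lbrakk>a \<in> Obj C; b \<in> Obj C\<rbrakk> \<Longrightarrow>
      tmor M a a b b (Ident C a) (Ident C b) = Ident C (tob M a b)"
    and tmor_comp: "\<lbrakk>a \<in> Obj C; a' \<in> Obj C; a'' \<in> Obj C; b \<in> Obj C; b' \<in> Obj C; b'' \<in> Obj C;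
        f \<in> mor C a a'; f' \<in> mor C a' a''; g \<in> mor C b b'; g' \<in> mor C b' b''\<rbrakk> \<Longrightarrow>
      tmor M a a'' b b'' (Comp C a a' a'' f' f) (Comp C b b' b'' g' g) =
      Comp C (tob M a b) (tob M a' b') (tob M a'' b'')
        (tmor M a' a'' b' b'' f' g') (tmor M a a' b b' f g)"

locale strict_semimonoidal_category = enriched_bifunctor T C M
  for T :: convenient_top and C :: "('o, 'm) top_cat" and M :: "('o, 'm) tensor" +
  assumes tob_assoc: "\<lbrakk>a \<in> Obj C; b \<in> Obj C; c \<in> Obj C\<rbrakk> \<Longrightarrow>
      tob M (tob M a b) c = tob M a (tob M b c)"
    and tmor_assoc: "\<lbrakk>a \<in> Obj C; a' \<in> Obj C; b \<in> Obj C; b' \<in> Obj C; c \<in> Obj C; c' \<in> Obj C;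
        f \<in> mor C a a'; g \<in> mor C b b'; h \<in> mor C c c'\<rbrakk> \<Longrightarrow>
      tmor M (tob M a b) (tob M a' b') c c' (tmor M a a' b b' f g) h =
      tmor M a a' (tob M b c) (tob M b' c') f (tmor M b b' c c' g h)"

text \<open>
  Since the associator is the identity, each hexagon reduces to the triangle below.
  An enriched natural transformation is given by points of the hom-spaces, and naturality is an
  equality between maps of spaces, that is, a pointwise condition. Invertibility of \<open>\<gamma> a b\<close> follows
  from \<open>sym_inverse\<close>.
\<close>

locale symmetric_strict_semimonoidal_category = strict_semimonoidal_category T C M
  for T :: convenient_top and C :: "('o, 'm) top_cat" and M :: "('o, 'm) tensor" +
  fixes \<gamma> :: "'o \<Rightarrow> 'o \<Rightarrow> 'm"
  assumes sym_mor: "\<lbrakk>a \<in> Obj C; b \<in> Obj C\<rbrakk> \<Longrightarrow> \<gamma> a b \<in> mor C (tob M a b) (tob M b a)"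
    and sym_natural: "\<lbrakk>a \<in> Obj C; a' \<in> Obj C; b \<in> Obj C; b' \<in> Obj C;
        f \<in> mor C a a'; g \<in> mor C b b'\<rbrakk> \<Longrightarrow>
      Comp C (tob M a b) (tob M a' b') (tob M b' a') (\<gamma> a' b') (tmor M a a' b b' f g) =
      Comp C (tob M a b) (tob M b a) (tob M b' a') (tmor M b b' a a' g f) (\<gamma> a b)"
    and sym_inverse: "\<lbrakk>a \<in> Obj C; b \<in> Obj C\<rbrakk> \<Longrightarrow>
      Comp C (tob M a b) (tob M b a) (tob M a b) (\<gamma> b a) (\<gamma> a b) = Ident C (tob M a b)"
    and hexagon_right: "\<lbrakk>a \<in> Obj C; b \<in> Obj C; c \<in> Obj C\<rbrakk> \<Longrightarrow>
      \<gamma> a (tob M b c) =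
      Comp C (tob M (tob M a b) c) (tob M b (tob M a c)) (tob M b (tob M c a))
        (tmor M b b (tob M a c) (tob M c a) (Ident C b) (\<gamma> a c))
        (tmor M (tob M a b) (tob M b a) c c (\<gamma> a b) (Ident C c))"
    and hexagon_left: "\<lbrakk>a \<in> Obj C; b \<in> Obj C; c \<in> Obj C\<rbrakk> \<Longrightarrow>
      \<gamma> (tob M a b) c =
      Comp C (tob M a (tob M b c)) (tob M (tob M a c) b) (tob M (tob M c a) b)
        (tmor M (tob M a c) (tob M c a) b b (\<gamma> a c) (Ident C b))
        (tmor M a a (tob M b c) (tob M c b) (Ident C a) (\<gamma> b c))"

locale strict_symmetric_monoidal_category = symmetric_strict_semimonoidal_category T C M \<gamma>
  for T :: convenient_top and C :: "('o, 'm) top_cat" and M :: "('o, 'm) tensor"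
    and \<gamma> :: "'o \<Rightarrow> 'o \<Rightarrow> 'm" +
  fixes e :: 'o
  assumes unit_Obj: "e \<in> Obj C"
    and unit_left: "a \<in> Obj C \<Longrightarrow> tob M e a = a"
    and unit_right: "a \<in> Obj C \<Longrightarrow> tob M a e = a"
    and unit_left_mor: "\<lbrakk>a \<in> Obj C; a' \<in> Obj C; f \<in> mor C a a'\<rbrakk> \<Longrightarrow>
      tmor M e e a a' (Ident C e) f = f"
    and unit_right_mor: "\<lbrakk>a \<in> Obj C; a' \<in> Obj C; f \<in> mor C a a'\<rbrakk> \<Longrightarrow>
      tmor M a a' e e f (Ident C e) = f"


section \<open>Reparametrization categories and cut structures\<close>

text \<open>
  \<open>contractible_space\<close> holds for the empty space, hence the nonemptiness condition. The homotopies
  in \<open>contractible_space\<close> are parametrized by \<open>prod_topology\<close>, which agrees with \<open>Top_prod\<close> here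
  since the product of \<open>[0,1]\<close> with a \<open>\<Delta>\<close>-generated space is \<open>\<Delta>\<close>-generated.
\<close>

locale reparametrization_category = strict_semimonoidal_category T P M
  for T :: convenient_top and P :: "('o, 'm) top_cat" and M :: "('o, 'm) tensor" +
  assumes hom_nonempty: "\<lbrakk>l \<in> Obj P; l' \<in> Obj P\<rbrakk> \<Longrightarrow> mor P l l' \<noteq> {}"
    and hom_contractible: "\<lbrakk>l \<in> Obj P; l' \<in> Obj P\<rbrakk> \<Longrightarrow> contractible_space (Hom P l l')"
    and factorization: "\<lbrakk>l \<in> Obj P; l' \<in> Obj P; \<phi> \<in> mor P l l'; l1' \<in> Obj P; l2' \<in> Obj P;
        l' = tob M l1' l2'\<rbrakk> \<Longrightarrow>
      \<exists>l1\<in>Obj P. \<exists>l2\<in>Obj P. \<exists>\<phi>1\<in>mor P l1 l1'. \<exists>\<phi>2\<in>mor P l2 l2'.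
        l = tob M l1 l2 \<and> \<phi> = tmor M l1 l1' l2 l2' \<phi>1 \<phi>2"

locale cut_structure = strict_semimonoidal_category T P M
  for T :: convenient_top and P :: "('o, 'm) top_cat" and M :: "('o, 'm) tensor" +
  fixes \<delta> :: "'o \<Rightarrow> 'm"
    and c1 c2 :: "'o \<Rightarrow> 'o \<Rightarrow> 'o \<Rightarrow> 'm \<Rightarrow> 'm"
    and \<Theta> :: "'o \<Rightarrow> 'o \<Rightarrow> 'o \<Rightarrow> real \<Rightarrow> 'm \<Rightarrow> 'm"
  assumes delta_mor: "L \<in> Obj P \<Longrightarrow> \<delta> L \<in> mor P L (tob M L L)"
    and c1_continuous: "\<lbrakk>L \<in> Obj P; a \<in> Obj P; b \<in> Obj P\<rbrakk> \<Longrightarrow>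
      continuous_map (Hom P L (tob M a b)) (Hom P L a) (c1 L a b)"
    and c2_continuous: "\<lbrakk>L \<in> Obj P; a \<in> Obj P; b \<in> Obj P\<rbrakk> \<Longrightarrow>
      continuous_map (Hom P L (tob M a b)) (Hom P L b) (c2 L a b)"
    and c1_natural: "\<lbrakk>L \<in> Obj P; a \<in> Obj P; a' \<in> Obj P; b \<in> Obj P; b' \<in> Obj P;
        \<alpha> \<in> mor P a a'; \<beta> \<in> mor P b b'; \<psi> \<in> mor P L (tob M a b)\<rbrakk> \<Longrightarrow>
      c1 L a' b' (Comp P L (tob M a b) (tob M a' b') (tmor M a a' b b' \<alpha> \<beta>) \<psi>) =
      Comp P L a a' \<alpha> (c1 L a b \<psi>)"
    and c2_natural: "\<lbrakk>L \<in> Obj P; a \<in> Obj P; a' \<in> Obj P; b \<in> Obj P; b' \<in> Obj P;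
        \<alpha> \<in> mor P a a'; \<beta> \<in> mor P b b'; \<psi> \<in> mor P L (tob M a b)\<rbrakk> \<Longrightarrow>
      c2 L a' b' (Comp P L (tob M a b) (tob M a' b') (tmor M a a' b b' \<alpha> \<beta>) \<psi>) =
      Comp P L b b' \<beta> (c2 L a b \<psi>)"
    and Theta_continuous: "\<lbrakk>L \<in> Obj P; a \<in> Obj P; b \<in> Obj P\<rbrakk> \<Longrightarrow>
      continuous_map (Top_prod (top_of_set {0..1}) (Hom P L (tob M a b))) (Hom P L (tob M a b))
        (\<lambda>(u, \<psi>). \<Theta> L a b u \<psi>)"
    and Theta_0: "\<lbrakk>L \<in> Obj P; a \<in> Obj P; b \<in> Obj P; \<psi> \<in> mor P L (tob M a b)\<rbrakk> \<Longrightarrow>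
      \<Theta> L a b 0 \<psi> = \<psi>"
    and Theta_1: "\<lbrakk>L \<in> Obj P; a \<in> Obj P; b \<in> Obj P; \<psi> \<in> mor P L (tob M a b)\<rbrakk> \<Longrightarrow>
      \<Theta> L a b 1 \<psi> = Comp P L (tob M L L) (tob M a b)
        (tmor M L a L b (c1 L a b \<psi>) (c2 L a b \<psi>)) (\<delta> L)"
    and Theta_natural: "\<lbrakk>L \<in> Obj P; a \<in> Obj P; a' \<in> Obj P; b \<in> Obj P; b' \<in> Obj P;
        \<alpha> \<in> mor P a a'; \<beta> \<in> mor P b b'; \<psi> \<in> mor P L (tob M a b); u \<in> {0..1}\<rbrakk> \<Longrightarrow>
      \<Theta> L a' b' u (Comp P L (tob M a b) (tob M a' b') (tmor M a a' b b' \<alpha> \<beta>) \<psi>) =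
      Comp P L (tob M a b) (tob M a' b') (tmor M a a' b b' \<alpha> \<beta>) (\<Theta> L a b u \<psi>)"

definition reparametrization_category_with_cuts ::
    "convenient_top \<Rightarrow> ('o, 'm) top_cat \<Rightarrow> ('o, 'm) tensor \<Rightarrow> bool" where
  "reparametrization_category_with_cuts T P M \<longleftrightarrow>
     reparametrization_category T P M \<and> (\<exists>\<delta> c1 c2 \<Theta>. cut_structure T P M \<delta> c1 c2 \<Theta>)"

definition symmetric_reparametrization_category_with_cuts ::
    "convenient_top \<Rightarrow> ('o, 'm) top_cat \<Rightarrow> ('o, 'm) tensor \<Rightarrow> ('o \<Rightarrow> 'o \<Rightarrow> 'm) \<Rightarrow> bool" where
  "symmetric_reparametrization_category_with_cuts T P M \<gamma> \<longleftrightarrow>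
     reparametrization_category_with_cuts T P M \<and> symmetric_strict_semimonoidal_category T P M \<gamma>"


section \<open>Equivalence of ordinary categories\<close>

record ('o, 'm) ord_cat =
  cObj :: "'o set"
  cHom :: "'o \<Rightarrow> 'o \<Rightarrow> 'm set"
  cIdent :: "'o \<Rightarrow> 'm"
  cComp :: "'o \<Rightarrow> 'o \<Rightarrow> 'o \<Rightarrow> 'm \<Rightarrow> 'm \<Rightarrow> 'm"

definition underlying_category :: "('o, 'm) top_cat \<Rightarrow> ('o, 'm) ord_cat" where
  "underlying_category C = \<lparr>cObj = Obj C, cHom = mor C, cIdent = Ident C, cComp = Comp C\<rparr>"

definition final_category :: "(unit, unit) ord_cat" where
  "final_category =
     \<lparr>cObj = {()}, cHom = (\<lambda>_ _. {()}), cIdent = (\<lambda>_. ()), cComp = (\<lambda>_ _ _ _ _. ())\<rparr>"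

definition cat_functor ::
    "('o, 'm) ord_cat \<Rightarrow> ('p, 'n) ord_cat \<Rightarrow> ('o \<Rightarrow> 'p) \<Rightarrow> ('o \<Rightarrow> 'o \<Rightarrow> 'm \<Rightarrow> 'n) \<Rightarrow> bool" where
  "cat_functor C D F Fm \<longleftrightarrow>
     (\<forall>x\<in>cObj C. F x \<in> cObj D) \<and>
     (\<forall>x\<in>cObj C. \<forall>y\<in>cObj C. \<forall>f\<in>cHom C x y. Fm x y f \<in> cHom D (F x) (F y)) \<and>
     (\<forall>x\<in>cObj C. Fm x x (cIdent C x) = cIdent D (F x)) \<and>
     (\<forall>x\<in>cObj C. \<forall>y\<in>cObj C. \<forall>z\<in>cObj C. \<forall>f\<in>cHom C x y. \<forall>g\<in>cHom C y z.
        Fm x z (cComp C x y z g f) = cComp D (F x) (F y) (F z) (Fm y z g) (Fm x y f))"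

definition cat_iso :: "('o, 'm) ord_cat \<Rightarrow> 'o \<Rightarrow> 'o \<Rightarrow> 'm \<Rightarrow> bool" where
  "cat_iso C x y f \<longleftrightarrow> f \<in> cHom C x y \<and>
     (\<exists>g\<in>cHom C y x. cComp C x y x g f = cIdent C x \<and> cComp C y x y f g = cIdent C y)"

definition natural_iso ::
    "('o, 'm) ord_cat \<Rightarrow> ('p, 'n) ord_cat \<Rightarrow>
     ('o \<Rightarrow> 'p) \<Rightarrow> ('o \<Rightarrow> 'o \<Rightarrow> 'm \<Rightarrow> 'n) \<Rightarrow> ('o \<Rightarrow> 'p) \<Rightarrow> ('o \<Rightarrow> 'o \<Rightarrow> 'm \<Rightarrow> 'n) \<Rightarrow>
     ('o \<Rightarrow> 'n) \<Rightarrow> bool" where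
  "natural_iso C D F Fm G Gm \<eta> \<longleftrightarrow>
     (\<forall>x\<in>cObj C. cat_iso D (F x) (G x) (\<eta> x)) \<and>
     (\<forall>x\<in>cObj C. \<forall>y\<in>cObj C. \<forall>f\<in>cHom C x y.
        cComp D (F x) (F y) (G y) (\<eta> y) (Fm x y f) =
        cComp D (F x) (G x) (G y) (Gm x y f) (\<eta> x))"

definition equivalent_categories :: "('o, 'm) ord_cat \<Rightarrow> ('p, 'n) ord_cat \<Rightarrow> bool" where
  "equivalent_categories C D \<longleftrightarrow>
     (\<exists>F Fm G Gm \<eta> \<epsilon>. cat_functor C D F Fm \<and> cat_functor D C G Gm \<and>
        natural_iso C C (\<lambda>x. x) (\<lambda>x y f. f)
          (\<lambda>x. G (F x)) (\<lambda>x y f. Gm (F x) (F y) (Fm x y f)) \<eta> \<and>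
        natural_iso D D (\<lambda>x. F (G x)) (\<lambda>x y f. Fm (G x) (G y) (Gm x y f))
          (\<lambda>x. x) (\<lambda>x y f. f) \<epsilon>)"


section \<open>The category with one object and endomorphism space \<open>[0,1]\<close>\<close>

definition P_times :: "(unit, real) top_cat" where
  "P_times =
     \<lparr>Obj = {()}, Hom = (\<lambda>_ _. top_of_set {0..1}), Ident = (\<lambda>_. 1), Comp = (\<lambda>_ _ _ t s. t * s)\<rparr>"

end

theory Submission
  imports Defs
begin

text \<open>
  A tensor product on a category with one object is a second multiplication on its endomorphisms
  that satisfies the interchange law. By the Eckmann--Hilton argument the only unital one on
  \<open>[0,1]\<close> is the multiplication itself, and it is a tensor product because \<open>[0,1]\<close> is a
  commutative monoid; the symmetry, the unitors and the associators are all the number \<open>1\<close>, and the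
  factorization axiom is \<open>\<phi> = \<phi> * 1\<close>.

  The cuts are forced as well. Naturality of \<open>c1\<close> reads \<open>c1 (\<alpha> * \<beta> * \<psi>) = \<alpha> * c1 \<psi>\<close>, and
  \<open>\<alpha> = 1\<close>, \<open>\<beta> = 0\<close> shows that \<open>c1\<close> is constant, hence (by \<open>\<alpha> = 0\<close>) equal to \<open>0\<close>; the same holds
  for \<open>c2\<close>. The normalization \<open>N\<close> is therefore the zero map, and the linear
  contraction \<open>(1 - u) * \<psi>\<close> of \<open>[0,1]\<close> onto \<open>0\<close> is a homotopy from the identity to it. That homotopy
  commutes with multiplication by \<open>\<alpha> * \<beta>\<close>, as required.

  On the topological side, \<open>[0,1]\<close> is a retract of (in fact homeomorphic to) the 1-simplex, so it
  is \<open>\<Delta>\<close>-generated, and it is \<open>\<Delta>\<close>-Hausdorff because it is Hausdorff. Since \<open>\<Delta>\<close>-kelleyfication only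
  adds open sets, a map that is continuous on the ordinary product is continuous on the
  product of Top.

  Finally, an equivalence is faithful, so in a category equivalent to the final one every object has
  only one endomorphism; but \<open>0\<close> and \<open>1\<close> are different endomorphisms of the object of \<open>P_times\<close>.
\<close>

lemma topspace_delta_kelleyfication [simp]: "topspace (delta_kelleyfication X) = topspace X"
proof
  show "topspace (delta_kelleyfication X) \<subseteq> topspace X"
    using openin_topspace[of "delta_kelleyfication X"]
    unfolding openin_delta_kelleyfication by blast
  have "openin (delta_kelleyfication X) (topspace X)"
    unfolding openin_delta_kelleyfication
    using openin_continuous_map_preimage by blast
  then show "topspace X \<subseteq> topspace (delta_kelleyfication X)"
    by (rule openin_subset)
qed

lemma openin_delta_kelleyfication_if_openin:
  "openin X U \<Longrightarrow> openin (delta_kelleyfication X) U"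
  unfolding openin_delta_kelleyfication
  using openin_continuous_map_preimage openin_subset by blast

lemma continuous_map_Top_prod:
  assumes "continuous_map (prod_topology X Y) Z f"
  shows "continuous_map (Top_prod X Y) Z f"
  using assms openin_delta_kelleyfication_if_openin
  unfolding continuous_map_def Top_prod_def by fastforce

text \<open>
  If a set has open preimage in the simplex under the retraction \<open>r\<close>, then pulling this preimage
  back along the section \<open>s\<close> recovers the set itself.
\<close>

lemma delta_generated_if_retract_of_simplex:
  assumes s: "continuous_map X (simplex_space p) s"
    and r: "continuous_map (simplex_space p) X r"
    and rs: "\<And>x. x \<in> topspace X \<Longrightarrow> r (s x) = x"
  shows "delta_generated X"
  unfolding delta_generated_def topology_eq
proof (intro allI iffI)
  fix U assume U: "openin (delta_kelleyfication X) U"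
  then have "openin X {x \<in> topspace X. s x \<in> {y \<in> topspace (simplex_space p). r y \<in> U}}"
    using s r openin_continuous_map_preimage
    unfolding openin_delta_kelleyfication by blast
  moreover have "{x \<in> topspace X. s x \<in> {y \<in> topspace (simplex_space p). r y \<in> U}} = U"
    using s rs U unfolding openin_delta_kelleyfication continuous_map_def Pi_iff by auto
  ultimately show "openin X U" by simp
qed (rule openin_delta_kelleyfication_if_openin)

lemma delta_Hausdorff_if_Hausdorff: "Hausdorff_space X \<Longrightarrow> delta_Hausdorff X"
  unfolding delta_Hausdorff_def
  by (metis compactin_imp_closedin image_compactin compactin_subtopology compact_Icc
      compactin_euclidean_iff subset_refl)

text \<open>The number \<open>t\<close> corresponds to the point with barycentric coordinates \<open>(t, 1 - t)\<close>.\<close>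

lemma delta_generated_unit_interval: "delta_generated (top_of_set {0..1::real})"
proof (rule delta_generated_if_retract_of_simplex)
  let ?s = "\<lambda>(t::real) i::nat. if i = 0 then t else if i = 1 then 1 - t else 0"
  have "continuous_map (top_of_set {0..1}) euclideanreal (\<lambda>t. ?s t i)" for i
    by (cases "i = 0"; cases "i = 1") (auto intro!: continuous_intros)
  moreover have "?s t \<in> standard_simplex 1" if "t \<in> {0..1}" for t
    using that by (auto simp: standard_simplex_def)
  ultimately show "continuous_map (top_of_set {0..1}) (simplex_space 1) ?s"
    by (auto simp: continuous_map_in_subtopology continuous_map_componentwise_UNIV)
  have "continuous_map (simplex_space 1) euclideanreal (\<lambda>x. x 0)"
    by (intro continuous_map_from_subtopology continuous_map_product_projection) simp
  moreover have "x 0 \<in> {0..1}" if "x \<in> standard_simplex 1" for x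
    using that by (auto simp: standard_simplex_def)
  ultimately show "continuous_map (simplex_space 1) (top_of_set {0..1}) (\<lambda>x. x 0)"
    by (auto simp: continuous_map_in_subtopology)
qed simp

lemma Top_object_unit_interval: "Top_object T (top_of_set {0..1::real})"
  by (cases T) (auto simp: delta_generated_unit_interval
      intro!: delta_Hausdorff_if_Hausdorff Hausdorff_space_subtopology Hausdorff_space_euclidean)

lemma continuous_map_mult_unit_interval:
  "continuous_map (Top_prod (top_of_set {0..1}) (top_of_set {0..1})) (top_of_set {0..1})
     (\<lambda>(t, s). t * s :: real)"
  by (intro continuous_map_Top_prod)
    (auto simp: prod_topology_subtopology_eu case_prod_unfold mult_le_one intro!: continuous_intros)

lemma continuous_map_contraction_unit_interval:
  "continuous_map (Top_prod (top_of_set {0..1}) (top_of_set {0..1})) (top_of_set {0..1})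
     (\<lambda>(u, t). (1 - u) * t :: real)"
  by (intro continuous_map_Top_prod)
    (auto simp: prod_topology_subtopology_eu case_prod_unfold mult_le_one intro!: continuous_intros)

definition times_tensor :: "(unit, real) tensor" where
  "times_tensor = \<lparr>tob = (\<lambda>_ _. ()), tmor = (\<lambda>_ _ _ _ f g. f * g)\<rparr>"

lemma P_times_simps [simp]:
  "Obj P_times = {()}" "Hom P_times x y = top_of_set {0..1}" "Ident P_times x = 1"
  "Comp P_times x y z t s = t * s"
  by (simp_all add: P_times_def)

lemma times_tensor_simps [simp]:
  "tob times_tensor x y = ()" "tmor times_tensor a a' b b' f g = f * g"
  by (simp_all add: times_tensor_def)

lemma strict_symmetric_monoidal_P_times:
  "strict_symmetric_monoidal_category T P_times times_tensor (\<lambda>_ _. 1) ()"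
  by unfold_locales
    (auto simp: Top_object_unit_interval continuous_map_mult_unit_interval)

lemma strict_semimonoidal_P_times: "strict_semimonoidal_category T P_times times_tensor"
  by (rule symmetric_strict_semimonoidal_category.axioms(1)
      [OF strict_symmetric_monoidal_category.axioms(1) [OF strict_symmetric_monoidal_P_times]])

lemma reparametrization_category_P_times: "reparametrization_category T P_times times_tensor"
proof -
  interpret strict_semimonoidal_category T P_times times_tensor
    by (rule strict_semimonoidal_P_times)
  have "contractible_space (top_of_set {0..1::real})"
    by (simp add: contractible_space_top_of_set convex_imp_contractible)
  moreover have "\<exists>s\<in>{0..1}. \<exists>t\<in>{0..1}. \<phi> = s * t" if "\<phi> \<in> {0..1}" for \<phi> :: real
    using that by (intro bexI[of _ \<phi>] bexI[of _ 1]) auto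
  ultimately show ?thesis
    by unfold_locales auto
qed

lemma cut_structure_P_times:
  "cut_structure T P_times times_tensor
     (\<lambda>_. 1) (\<lambda>_ _ _ _. 0) (\<lambda>_ _ _ _. 0) (\<lambda>_ _ _ u \<psi>. (1 - u) * \<psi>)"
proof -
  interpret strict_semimonoidal_category T P_times times_tensor
    by (rule strict_semimonoidal_P_times)
  show ?thesis
    by unfold_locales (auto simp: continuous_map_contraction_unit_interval)
qed

text \<open>
  The composite functor through the final category identifies all endomorphisms of \<open>x\<close>.
  It is naturally isomorphic to the identity functor, and the isomorphism can be cancelled.
\<close>

lemma endomorphism_unique_if_equivalent_final:
  assumes equiv: "equivalent_categories C final_category"
    and x: "x \<in> cObj C" and f: "f \<in> cHom C x x" and g: "g \<in> cHom C x x"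
    and assoc: "\<And>y h k l. \<lbrakk>y \<in> cObj C; l \<in> cHom C x x; k \<in> cHom C x y; h \<in> cHom C y x\<rbrakk> \<Longrightarrow>
      cComp C x x x (cComp C x y x h k) l = cComp C x y x h (cComp C x x y k l)"
    and ident: "\<And>l. l \<in> cHom C x x \<Longrightarrow> cComp C x x x (cIdent C x) l = l"
  shows "f = g"
proof -
  obtain F Fm G Gm \<eta> where F: "cat_functor C final_category F Fm"
    and G: "cat_functor final_category C G Gm"
    and \<eta>: "natural_iso C C (\<lambda>x. x) (\<lambda>x y f. f)
      (\<lambda>x. G (F x)) (\<lambda>x y f. Gm (F x) (F y) (Fm x y f)) \<eta>"
    using equiv unfolding equivalent_categories_def by blast
  let ?y = "G (F x)"
  have y: "?y \<in> cObj C"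
    using G by (simp add: cat_functor_def final_category_def)
  obtain h where \<eta>x: "\<eta> x \<in> cHom C x ?y" and h: "h \<in> cHom C ?y x"
    and inv: "cComp C x ?y x h (\<eta> x) = cIdent C x"
    using \<eta> x unfolding natural_iso_def cat_iso_def by blast
  \<comment> \<open>Both morphisms have the same image in the final category, whose morphisms have type \<open>unit\<close>.\<close>
  have nat: "cComp C x x ?y (\<eta> x) l = cComp C x ?y ?y (Gm (F x) (F x) ()) (\<eta> x)"
    if "l \<in> cHom C x x" for l
    using \<eta> x that unfolding natural_iso_def by (simp add: unit_eq[of "Fm x x l"])
  have "f = cComp C x ?y x h (cComp C x x ?y (\<eta> x) f)"
    using assoc[OF y f \<eta>x h] ident[OF f] inv by simp
  also have "\<dots> = cComp C x ?y x h (cComp C x x ?y (\<eta> x) g)"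
    using nat[OF f] nat[OF g] by simp
  also have "\<dots> = g"
    using assoc[OF y g \<eta>x h] ident[OF g] inv by simp
  finally show ?thesis .
qed

lemma P_times_not_equivalent_final:
  "\<not> equivalent_categories (underlying_category P_times) final_category"
proof
  assume "equivalent_categories (underlying_category P_times) final_category"
  then have "(0::real) = 1"
    by (rule endomorphism_unique_if_equivalent_final[where x = "()"])
      (auto simp: underlying_category_def)
  then show False by simp
qed

theorem theorem9p2:
  fixes T :: convenient_top
  shows "(\<exists>M \<gamma> e \<delta> c1 c2 \<Theta>.
            strict_symmetric_monoidal_category T P_times M \<gamma> e \<and>
            cut_structure T P_times M \<delta> c1 c2 \<Theta> \<and>
            symmetric_reparametrization_category_with_cuts T P_times M \<gamma>) \<and>
         \<not> equivalent_categories (underlying_category P_times) final_category"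
proof -
  have "symmetric_reparametrization_category_with_cuts T P_times times_tensor (\<lambda>_ _. 1)"
    unfolding symmetric_reparametrization_category_with_cuts_def
      reparametrization_category_with_cuts_def
    using reparametrization_category_P_times cut_structure_P_times
      strict_symmetric_monoidal_category.axioms(1)[OF strict_symmetric_monoidal_P_times]
    by blast
  then show ?thesis
    using strict_symmetric_monoidal_P_times cut_structure_P_times P_times_not_equivalent_final
    by blast
qed

end
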